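(* For an integer $m\ge 2$ and $t\in[0,1)$ let \[ \Phi_t(z)=\left(\frac{z-t}{1-tz}\right)^2\left(\frac{z-t^{1/m}}{1-t^{1/m}z}\right). \] Set $t_2=0.11$, $t_3=0.27$, $t_4=0.41$, $t_5=0.50$, $t_6=0.57$, $t_7=0.62$. Then for each integer $m$ with $2\le m\le 7$ and each $t\in(t_m,1)$, $W(M_{\Phi_t})$ contains a pseudohyperbolic disk with radius $\frac{1}{\sqrt2}$; that is, there is a $z_0\in\mathbb{D}$ with $D_\rho\left(z_0,\tfrac{1}{\sqrt2}\right)\subseteq W(M_{\Phi_t})$.
   Context: $\mathbb{D}$ is the open unit disk in $\mathbb{C}$. For an $n\times n$ complex matrix $A$, the numerical range is $W(A)=\{\langle Ax,x\rangle : x\in\mathbb{C}^n,\ \|x\|=1\}$. For $z_0\in\mathbb{D}$ and $r\in(0,1)$, the pseudohyperbolic disk with center $z_0$ and radius $r$ is $D_\rho(z_0,r)=\{z\in\mathbb{D}: |\frac{z-z_0}{1-\overline{z_0}z}|<r\}$. For a finite Blaschke product $\Theta(z)=\prod_{j=1}^n\frac{z-a_j}{1-\overline{a_j}z}$ with zeros $a_1,\dots,a_n\in\mathbb{D}$ (listed with multiplicity), $M_\Theta$ is the upper triangular $n\times n$ matrix with entries $(M_\Theta)_{ii}=a_i$, $(M_\Theta)_{ij}=0$ for $i>j$, and $(M_\Theta)_{ij}=\sqrt{1-|a_i|^2}\sqrt{1-|a_j|^2}\prod_{k=i+1}^{j-1}(-\overline{a_k})$ for $i<j$ (an empty product equals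 $1$). For $\Phi_t$ we have $n=3$ and the zeros are listed in the order $t,t,t^{1/m}$. *)

theory Defs
  imports "HOL-Analysis.Elementary_Metric_Spaces" "Jordan_Normal_Form.Matrix"
begin

definition cvec_norm :: "complex vec \<Rightarrow> real" where
  "cvec_norm x = sqrt (Re (x \<bullet>c x))"

definition numerical_range :: "complex mat \<Rightarrow> complex set" where
  "numerical_range A =
     {(A *\<^sub>v x) \<bullet>c x | x. x \<in> carrier_vec (dim_row A) \<and> cvec_norm x = 1}"

definition pseudohyperbolic_disk :: "complex \<Rightarrow> real \<Rightarrow> complex set" where
  "pseudohyperbolic_disk z0 r =
     {z \<in> ball 0 1. cmod ((z - z0) / (1 - cnj z0 * z)) < r}"

definition finite_blaschke :: "complex list \<Rightarrow> complex \<Rightarrow> complex" where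
  "finite_blaschke as z = (\<Prod>a\<leftarrow>as. (z - a) / (1 - cnj a * z))"

(* The matrix attached to the finite Blaschke product with zeros as, listed with
   multiplicity; it depends on the order of the list.  Indices start at 0, so a_(i+1) is as ! i. *)
definition blaschke_matrix :: "complex list \<Rightarrow> complex mat" where
  "blaschke_matrix as = mat (length as) (length as) (\<lambda>(i, j).
     if i = j then as ! i
     else if j < i then 0
     else of_real (sqrt (1 - (cmod (as ! i))\<^sup>2) * sqrt (1 - (cmod (as ! j))\<^sup>2))
            * (\<Prod>k\<in>{i<..<j}. - cnj (as ! k)))"

definition Phi :: "nat \<Rightarrow> real \<Rightarrow> complex \<Rightarrow> complex" where
  "Phi m t z = ((z - of_real t) / (1 - of_real t * z)) ^ 2 *
     ((z - of_real (root m t)) / (1 - of_real (root m t) * z))"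

definition Phi_zeros :: "nat \<Rightarrow> real \<Rightarrow> complex list" where
  "Phi_zeros m t = [of_real t, of_real t, of_real (root m t)]"

lemma Phi_eq_finite_blaschke: "Phi m t = finite_blaschke (Phi_zeros m t)"
  by (rule ext) (simp add: Phi_def Phi_zeros_def finite_blaschke_def power2_eq_square mult.assoc)

lemma Phi_zeros_in_disk:
  assumes "m \<ge> 2" "0 \<le> t" "t < 1"
  shows "set (Phi_zeros m t) \<subseteq> ball 0 1"
  using assms by (auto simp: Phi_zeros_def)

(* threshold m is t_m; only meaningful for 2 \<le> m \<le> 7. *)
definition threshold :: "nat \<Rightarrow> real" where
  "threshold m = [0.11, 0.27, 0.41, 0.50, 0.57, 0.62] ! (m - 2)"

end

theory Submission
  imports Defs "HOL-Analysis.Starlike"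
begin

text \<open>
  Write \<open>a = t\<close>, \<open>b = root m t\<close> and let \<open>M\<close> be the matrix of \<open>\<Phi>\<^sub>t\<close>. The disk of centre \<open>c\<close> and
  radius \<open>R\<close>, with \<open>c\<close> real, lies in the convex set \<open>W(M)\<close> as soon as for every unimodular \<open>w\<close> the
  Hermitian matrix \<open>(c Re w + R) I - Re(cnj w M)\<close> takes a nonpositive value, for which it suffices
  that its determinant is nonpositive. That determinant is a cubic polynomial in \<open>u = Re w\<close> whose
  coefficients are polynomials in \<open>a\<close>, \<open>b\<close>, \<open>c\<close>, \<open>R\<close>, and it is convex in \<open>b\<close>. A Euclidean disk contains a
  pseudohyperbolic disk of radius \<open>1 / sqrt 2\<close> when \<open>sqrt 2 (1 - c\<^sup>2 + R\<^sup>2) \<le> 3 R\<close>.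
  For \<open>a \<ge> 7/8\<close> the choice \<open>c = a\<close>, \<open>R = (1 - a\<^sup>2) / 2\<close> works. The remaining range of \<open>a\<close> splits into five
  intervals, on each of which \<open>c\<close> is taken linear and \<open>R\<close> quadratic in \<open>a\<close>; the inequalities then
  follow from the signs of Bernstein coefficients.
\<close>

section \<open>Convexity of the numerical range\<close>

text \<open>With the identity matrix for \<open>A\<close>, the same formula expands squared
  norms.\<close>

lemma quadratic_form_lincomb:
  fixes A :: "complex mat"
  assumes A: "A \<in> carrier_mat n n" and x: "x \<in> carrier_vec n" and y: "y \<in> carrier_vec n"
  shows "(A *\<^sub>v (\<alpha> \<cdot>\<^sub>v x + \<beta> \<cdot>\<^sub>v y)) \<bullet>c (\<alpha> \<cdot>\<^sub>v x + \<beta> \<cdot>\<^sub>v y) =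
    \<alpha> * cnj \<alpha> * ((A *\<^sub>v x) \<bullet>c x) + \<beta> * cnj \<beta> * ((A *\<^sub>v y) \<bullet>c y) +
    \<alpha> * cnj \<beta> * ((A *\<^sub>v x) \<bullet>c y) + \<beta> * cnj \<alpha> * ((A *\<^sub>v y) \<bullet>c x)"
proof -
  have Ax: "A *\<^sub>v x \<in> carrier_vec n" and Ay: "A *\<^sub>v y \<in> carrier_vec n"
    using mult_mat_vec_carrier[OF A x] mult_mat_vec_carrier[OF A y] .
  have cx: "conjugate x \<in> carrier_vec n" and cy: "conjugate y \<in> carrier_vec n"
    using x y by auto
  have "A *\<^sub>v (\<alpha> \<cdot>\<^sub>v x + \<beta> \<cdot>\<^sub>v y) = \<alpha> \<cdot>\<^sub>v (A *\<^sub>v x) + \<beta> \<cdot>\<^sub>v (A *\<^sub>v y)"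
    using A x y by (simp add: mult_add_distrib_mat_vec[of A n n] mult_mat_vec[of A n n])
  moreover have "conjugate (\<alpha> \<cdot>\<^sub>v x + \<beta> \<cdot>\<^sub>v y) = cnj \<alpha> \<cdot>\<^sub>v conjugate x + cnj \<beta> \<cdot>\<^sub>v conjugate y"
    using x y by (simp add: conjugate_add_vec[of _ n] conjugate_smult_vec)
  ultimately show ?thesis
    using Ax Ay cx cy
    by (simp add: add_scalar_prod_distrib[of _ n] scalar_prod_add_distrib[of _ n]
        scalar_prod_smult_distrib[of _ n] smult_scalar_prod_distrib[of _ n] algebra_simps)
qed

lemma self_inner_eq: "x \<bullet>c x = of_real (Re (x \<bullet>c x))" for x :: "complex Matrix.vec"
  using conjugate_square_ge_0_vec[of x] by (simp add: less_eq_complex_def complex_eq_iff)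

lemma Re_self_inner_nonneg: "0 \<le> Re (x \<bullet>c x)" for x :: "complex Matrix.vec"
  using conjugate_square_ge_0_vec[of x] by (simp add: less_eq_complex_def)

lemma Re_self_inner_pos:
  assumes "x \<in> carrier_vec n" "x \<noteq> 0\<^sub>v n"
  shows "0 < Re (x \<bullet>c x)"
proof -
  have "x \<bullet>c x \<noteq> 0"
    using assms by (simp add: conjugate_square_eq_0_vec)
  then show ?thesis
    using Re_self_inner_nonneg[of x] self_inner_eq[of x]
    by (cases "Re (x \<bullet>c x) = 0") auto
qed

text \<open>Working with Rayleigh quotients lets later witnesses stay unnormalised.\<close>

lemma quotient_in_numerical_range:
  assumes A: "A \<in> carrier_mat n n" and x: "x \<in> carrier_vec n" and "x \<noteq> 0\<^sub>v n"
  shows "((A *\<^sub>v x) \<bullet>c x) / of_real (Re (x \<bullet>c x)) \<in> numerical_range A"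
proof -
  define N where "N = Re (x \<bullet>c x)"
  have N: "N > 0"
    using Re_self_inner_pos assms by (simp add: N_def)
  define k where "k = complex_of_real (1 / sqrt N)"
  have kk: "k * cnj k = of_real (1 / N)"
    using N by (simp add: k_def flip: of_real_mult)
  \<comment> \<open>The zero summand turns the expansion lemma into homogeneity of the form.\<close>
  have eq: "k \<cdot>\<^sub>v x + 0 \<cdot>\<^sub>v x = k \<cdot>\<^sub>v x"
    using x by auto
  have 1: "(A *\<^sub>v (k \<cdot>\<^sub>v x)) \<bullet>c (k \<cdot>\<^sub>v x) = ((A *\<^sub>v x) \<bullet>c x) / of_real N"
    using quadratic_form_lincomb[OF A x x, of k 0] by (simp add: eq kk)
  have "(1\<^sub>m n *\<^sub>v (k \<cdot>\<^sub>v x)) \<bullet>c (k \<cdot>\<^sub>v x) = ((1\<^sub>m n *\<^sub>v x) \<bullet>c x) / of_real N"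
    using quadratic_form_lincomb[OF one_carrier_mat x x, of k 0] by (simp add: eq kk)
  then have "(k \<cdot>\<^sub>v x) \<bullet>c (k \<cdot>\<^sub>v x) = 1"
    using x assms(3) self_inner_eq[of x] N by (simp add: N_def)
  then have "cvec_norm (k \<cdot>\<^sub>v x) = 1"
    by (simp add: cvec_norm_def)
  then show ?thesis
    unfolding numerical_range_def N_def[symmetric] using 1 A x
    by (intro CollectI exI[of _ "k \<cdot>\<^sub>v x"]) auto
qed

lemma exists_unimodular_real_mult: "\<exists>w::complex. cmod w = 1 \<and> Im (w * k) = 0"
proof (cases "k = 0")
  case True
  then show ?thesis by (intro exI[of _ 1]) simp
next
  case False
  then show ?thesis
    by (intro exI[of _ "cnj k / cmod k"]) (auto simp: norm_divide)
qed

text \<open>Normalise the form affinely so that it is 0 at \<open>x\<close> and 1 at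
  \<open>y\<close>. On a path from a unimodular multiple of \<open>x\<close> to \<open>y\<close>
  whose phase makes the cross terms real, the Rayleigh quotient is real and continuous, so it takes
  every value in the unit interval.\<close>

theorem Toeplitz_Hausdorff:
  fixes A :: "complex mat"
  assumes A: "A \<in> carrier_mat n n"
  shows "convex (numerical_range A)"
  unfolding convex_contains_segment
proof (intro ballI)
  fix p q assume pW: "p \<in> numerical_range A" and qW: "q \<in> numerical_range A"
  show "closed_segment p q \<subseteq> numerical_range A"
  proof (cases "p = q")
    case True
    then show ?thesis using pW by simp
  next
    case False
    obtain x where x: "x \<in> carrier_vec n" and px: "p = (A *\<^sub>v x) \<bullet>c x" and nx: "cvec_norm x = 1"
      using pW A by (auto simp: numerical_range_def)
    obtain y where y: "y \<in> carrier_vec n" and qy: "q = (A *\<^sub>v y) \<bullet>c y" and ny: "cvec_norm y = 1"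
      using qW A by (auto simp: numerical_range_def)
    have xx: "x \<bullet>c x = 1" and yy: "y \<bullet>c y = 1"
      using nx ny self_inner_eq[of x] self_inner_eq[of y] by (auto simp: cvec_norm_def)
    \<comment> \<open>Cross terms of the form of \<open>(A - p I) / (q - p)\<close>, which is 0 at
      \<open>x\<close> and 1 at \<open>y\<close>.\<close>
    define h1 where "h1 = ((A *\<^sub>v x) \<bullet>c y - p * (x \<bullet>c y)) / (q - p)"
    define h2 where "h2 = ((A *\<^sub>v y) \<bullet>c x - p * (y \<bullet>c x)) / (q - p)"
    \<comment> \<open>The condition says that \<open>w * h1 + cnj w * h2\<close> has imaginary part
      0.\<close>
    obtain w where w: "cmod w = 1" and imw: "Im (w * (h1 - cnj h2)) = 0"
      using exists_unimodular_real_mult by blast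
    have ww: "w * cnj w = 1"
      using w by (simp add: complex_norm_square[symmetric])
    define r where "r = Re (w * h1 + cnj w * h2)"
    have r: "w * h1 + cnj w * h2 = of_real r"
      using imw by (simp add: r_def complex_eq_iff algebra_simps)
    define z where "z \<tau> = (of_real (1 - \<tau>) * w) \<cdot>\<^sub>v x + of_real \<tau> \<cdot>\<^sub>v y" for \<tau> :: real
    have zc: "z \<tau> \<in> carrier_vec n" for \<tau>
      using x y by (simp add: z_def)
    define g where "g \<tau> = \<tau>\<^sup>2 + \<tau> * (1 - \<tau>) * r" for \<tau> :: real
    define s where "s = Re (w * (x \<bullet>c y) + cnj w * (y \<bullet>c x))"
    define N where "N \<tau> = (1 - \<tau>)\<^sup>2 + \<tau>\<^sup>2 + \<tau> * (1 - \<tau>) * s" for \<tau> :: real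
    have unit: "of_real a * w * cnj (of_real a * w) = (of_real (a\<^sup>2) :: complex)" for a
      using ww by (simp add: power2_eq_square)
    have zz: "z \<tau> \<bullet>c z \<tau> = of_real ((1 - \<tau>)\<^sup>2) + of_real (\<tau>\<^sup>2) +
        of_real (\<tau> * (1 - \<tau>)) * (w * (x \<bullet>c y) + cnj w * (y \<bullet>c x))" for \<tau>
    proof -
      have "(1\<^sub>m n *\<^sub>v z \<tau>) \<bullet>c z \<tau> =
          of_real ((1 - \<tau>)\<^sup>2) * ((1\<^sub>m n *\<^sub>v x) \<bullet>c x) +
          of_real \<tau> * cnj (of_real \<tau>) * ((1\<^sub>m n *\<^sub>v y) \<bullet>c y) +
          (of_real (1 - \<tau>) * w) * cnj (of_real \<tau>) * ((1\<^sub>m n *\<^sub>v x) \<bullet>c y) +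
          of_real \<tau> * cnj (of_real (1 - \<tau>) * w) * ((1\<^sub>m n *\<^sub>v y) \<bullet>c x)"
        unfolding z_def quadratic_form_lincomb[OF one_carrier_mat x y] unit ..
      then show ?thesis
        using x y zc xx yy by (simp add: power2_eq_square algebra_simps)
    qed
    have N: "Re (z \<tau> \<bullet>c z \<tau>) = N \<tau>" for \<tau>
      unfolding zz N_def s_def by simp
    then have zz': "z \<tau> \<bullet>c z \<tau> = of_real (N \<tau>)" for \<tau>
      using self_inner_eq[of "z \<tau>"] by simp
    have Q: "(A *\<^sub>v z \<tau>) \<bullet>c z \<tau> = p * of_real (N \<tau>) + (q - p) * of_real (g \<tau>)" for \<tau>
    proof -
      have qp: "(A *\<^sub>v x) \<bullet>c y = (q - p) * h1 + p * (x \<bullet>c y)"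
        "(A *\<^sub>v y) \<bullet>c x = (q - p) * h2 + p * (y \<bullet>c x)"
        using False by (simp_all add: h1_def h2_def)
      have "(A *\<^sub>v z \<tau>) \<bullet>c z \<tau> = of_real ((1 - \<tau>)\<^sup>2) * p + of_real (\<tau>\<^sup>2) * q +
          of_real (\<tau> * (1 - \<tau>)) * (w * ((A *\<^sub>v x) \<bullet>c y) + cnj w * ((A *\<^sub>v y) \<bullet>c x))"
        unfolding z_def quadratic_form_lincomb[OF A x y] unit px qy
        by (simp add: power2_eq_square algebra_simps)
      also have "\<dots> = p * (z \<tau> \<bullet>c z \<tau>) + (q - p) * (of_real (\<tau>\<^sup>2) + of_real (\<tau> * (1 - \<tau>)) * (w * h1 + cnj w * h2))"
        unfolding qp zz by (simp add: algebra_simps)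
      finally show ?thesis
        unfolding r zz' by (simp add: g_def)
    qed
    \<comment> \<open>A zero on the path makes \<open>x\<close> and \<open>y\<close> parallel.
      Comparing squared norms gives \<open>\<tau> = 1 / 2\<close>, so \<open>y\<close> is a
      unimodular multiple of \<open>x\<close> and \<open>p = q\<close>.\<close>
    have Npos: "N \<tau> > 0" for \<tau>
    proof (rule ccontr)
      assume "\<not> N \<tau> > 0"
      then have z0: "z \<tau> = 0\<^sub>v n"
        using Re_self_inner_pos[OF zc, of \<tau>] N by auto
      then have N0: "N \<tau> = 0"
        using N[of \<tau>] by simp
      have g0: "g \<tau> = 0"
        using Q[of \<tau>] z0 A N0 False by simp
      have "of_real (1 - \<tau>) * w * (x $ i) = - of_real \<tau> * (y $ i)" if "i < n" for i
      proof -
        have "(z \<tau>) $ i = 0"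
          using z0 that by simp
        then show ?thesis
          using that x y by (simp add: z_def add_eq_0_iff)
      qed
      \<comment> \<open>Both sides are padded to linear combinations so that the expansion lemma
        applies to each.\<close>
      then have eq: "(of_real (1 - \<tau>) * w) \<cdot>\<^sub>v x + 0 \<cdot>\<^sub>v y = 0 \<cdot>\<^sub>v x + (- of_real \<tau>) \<cdot>\<^sub>v y"
        using x y by (intro eq_vecI) auto
      have key: "of_real ((1 - \<tau>)\<^sup>2) * ((B *\<^sub>v x) \<bullet>c x) = of_real (\<tau>\<^sup>2) * ((B *\<^sub>v y) \<bullet>c y)"
        if B: "B \<in> carrier_mat n n" for B
      proof -
        let ?u = "(of_real (1 - \<tau>) * w) \<cdot>\<^sub>v x + 0 \<cdot>\<^sub>v y" and ?v = "0 \<cdot>\<^sub>v x + (- of_real \<tau>) \<cdot>\<^sub>v y"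
        have "(B *\<^sub>v ?u) \<bullet>c ?u = of_real ((1 - \<tau>)\<^sup>2) * ((B *\<^sub>v x) \<bullet>c x)"
          unfolding quadratic_form_lincomb[OF B x y] unit by simp
        moreover have "(B *\<^sub>v ?v) \<bullet>c ?v = of_real (\<tau>\<^sup>2) * ((B *\<^sub>v y) \<bullet>c y)"
          unfolding quadratic_form_lincomb[OF B x y] by (simp add: power2_eq_square)
        ultimately show ?thesis
          unfolding eq by (rule trans[OF sym])
      qed
      have "complex_of_real ((1 - \<tau>)\<^sup>2) = of_real (\<tau>\<^sup>2)"
        using key[OF one_carrier_mat] x y xx yy by simp
      then have "(1 - \<tau>)\<^sup>2 = \<tau>\<^sup>2"
        using of_real_eq_iff by blast
      then have half: "\<tau> = 1 / 2"
        by (simp add: power2_eq_square algebra_simps)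
      have "p = q"
        using key[OF A] by (simp add: half px qy)
      with False show False ..
    qed
    show ?thesis
    proof
      fix v assume "v \<in> closed_segment p q"
      then obtain \<mu> where \<mu>: "0 \<le> \<mu>" "\<mu> \<le> 1" and v: "v = p + of_real \<mu> * (q - p)"
        by (auto simp: in_segment scaleR_conv_of_real algebra_simps)
      have "\<exists>\<tau>\<ge>0. \<tau> \<le> 1 \<and> g \<tau> / N \<tau> = \<mu>"
      proof (rule IVT')
        show "g 0 / N 0 \<le> \<mu>" "\<mu> \<le> g 1 / N 1" "(0::real) \<le> 1"
          using \<mu> by (auto simp: g_def N_def)
        have "N \<tau> \<noteq> 0" for \<tau>
          using Npos[of \<tau>] by simp
        then show "continuous_on {0..1} (\<lambda>\<tau>. g \<tau> / N \<tau>)"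
          by (intro continuous_on_divide) (auto simp: g_def N_def intro!: continuous_intros)
      qed
      then obtain \<tau> where \<tau>: "g \<tau> / N \<tau> = \<mu>" by blast
      have "v = ((A *\<^sub>v z \<tau>) \<bullet>c z \<tau>) / of_real (Re (z \<tau> \<bullet>c z \<tau>))"
        unfolding Q N v \<tau>[symmetric] using Npos[of \<tau>] by (simp add: field_simps)
      moreover have "z \<tau> \<noteq> 0\<^sub>v n"
        using N[of \<tau>] Npos[of \<tau>] by auto
      ultimately show "v \<in> numerical_range A"
        using quotient_in_numerical_range[OF A zc] by simp
    qed
  qed
qed

text \<open>A point of the ball outside \<open>closure S\<close> could be strictly separated from
  it, and \<open>S\<close> would then miss the support value demanded in the direction opposite to
  the normal. So the open ball lies in \<open>interior (closure S)\<close>, which for convex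
  \<open>S\<close> equals \<open>interior S\<close>.\<close>

lemma ball_subset_convex:
  fixes S :: "'a::euclidean_space set"
  assumes S: "convex S"
    and supp: "\<And>v. norm v = 1 \<Longrightarrow> \<exists>w\<in>S. inner v c + R \<le> inner v w"
  shows "ball c R \<subseteq> S"
proof -
  have "ball c R \<subseteq> closure S"
  proof (rule ccontr)
    assume "\<not> ball c R \<subseteq> closure S"
    then obtain z where z: "dist c z < R" "z \<notin> closure S"
      unfolding subset_iff mem_ball by blast
    obtain a b where ab: "inner a z < b" "\<And>x. x \<in> closure S \<Longrightarrow> b < inner a x"
      using separating_hyperplane_closed_point[of "closure S" z] z S
      by (auto simp: convex_closure)
    obtain v0 :: 'a where "norm v0 = 1"
      using vector_choose_size[of 1] by auto
    then obtain w0 where "w0 \<in> S"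
      using supp by blast
    then have "a \<noteq> 0"
      using ab closure_subset by fastforce
    define v where "v = (- 1 / norm a) *\<^sub>R a"
    have "norm v = 1"
      using \<open>a \<noteq> 0\<close> by (simp add: v_def)
    then obtain w where w: "w \<in> S" "inner v c + R \<le> inner v w"
      using supp by blast
    have "inner a z < inner a w"
      using ab(1) ab(2)[of w] w(1) closure_subset by fastforce
    then have "inner v w < inner v z"
      using \<open>a \<noteq> 0\<close> by (simp add: v_def divide_strict_right_mono)
    moreover have "inner v (z - c) \<le> dist c z"
      using norm_cauchy_schwarz[of v "z - c"] \<open>norm v = 1\<close> by (simp add: dist_norm norm_minus_commute)
    ultimately show False
      using w(2) z(1) by (simp add: inner_diff_right)
  qed
  then have "ball c R \<subseteq> interior (closure S)"
    by (simp add: interior_maximal)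
  then show ?thesis
    using S convex_interior_closure[of S] interior_subset by blast
qed

section \<open>Disks in the numerical range\<close>

text \<open>When the leading \<open>2 \<times> 2\<close> minor is positive, the witness is the third column of the
  adjugate matrix, on which the form equals that minor times the determinant.\<close>

lemma hermitian3_nonpos_vector:
  fixes p q r :: real and e f g :: complex
  assumes det: "p * q * r - p * (cmod g)\<^sup>2 - q * (cmod f)\<^sup>2 - r * (cmod e)\<^sup>2
      + 2 * Re (e * g * cnj f) \<le> 0"
  obtains x y z :: complex where "(x, y, z) \<noteq> (0, 0, 0)"
    "p * (cmod x)\<^sup>2 + q * (cmod y)\<^sup>2 + r * (cmod z)\<^sup>2
      + 2 * Re (e * y * cnj x + f * z * cnj x + g * z * cnj y) \<le> 0"
proof -
  consider "p \<le> 0" | "p > 0" "p * q - (cmod e)\<^sup>2 \<le> 0" | "p > 0" "p * q - (cmod e)\<^sup>2 > 0"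
    by linarith
  then show ?thesis
  proof cases
    case 1
    then show ?thesis by (intro that[of 1 0 0]) auto
  next
    case 2
    \<comment> \<open>The form at \<open>(- e, p, 0)\<close> is \<open>p\<close> times the leading 2
      by 2 minor.\<close>
    have "p * (cmod e)\<^sup>2 + q * p\<^sup>2 + 2 * Re (e * of_real p * cnj (- e)) = p * (p * q - (cmod e)\<^sup>2)"
      unfolding cmod_power2 by (simp add: power2_eq_square algebra_simps)
    also have "\<dots> \<le> 0"
      using 2 by (simp add: mult_nonneg_nonpos)
    finally show ?thesis
      using 2 by (intro that[of "- e" "of_real p" 0]) auto
  next
    case 3
    define M where "M = p * q - (cmod e)\<^sup>2"
    define x where "x = e * g - of_real q * f"
    define y where "y = cnj e * f - of_real p * g"
    have "p * (cmod x)\<^sup>2 + q * (cmod y)\<^sup>2 + r * (cmod (of_real M))\<^sup>2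
        + 2 * Re (e * y * cnj x + f * of_real M * cnj x + g * of_real M * cnj y) =
        M * (p * q * r - p * (cmod g)\<^sup>2 - q * (cmod f)\<^sup>2 - r * (cmod e)\<^sup>2 + 2 * Re (e * g * cnj f))"
      unfolding M_def x_def y_def cmod_power2
      by (simp add: power2_eq_square algebra_simps)
    also have "\<dots> \<le> 0"
      using 3 det by (simp add: M_def mult_nonneg_nonpos)
    finally show ?thesis
      using 3 by (intro that[of x y "of_real M"]) (simp_all add: M_def[symmetric])
  qed
qed

section \<open>Three-dimensional forms in coordinates and the determinant criterion\<close>

lemma atLeast0LessThan_3: "{0..<3} = {0, 1, 2::nat}"
  by auto

lemma inner_vec3:
  fixes v w :: "complex Matrix.vec"
  assumes "w \<in> carrier_vec 3"
  shows "v \<bullet>c w = v $ 0 * cnj (w $ 0) + v $ 1 * cnj (w $ 1) + v $ 2 * cnj (w $ 2)"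
  using assms by (simp add: scalar_prod_def atLeast0LessThan_3 add.assoc)

lemma mult_mat_vec3:
  assumes "M \<in> carrier_mat 3 3" "v \<in> carrier_vec 3"
  shows "(M *\<^sub>v v) $ 0 = M $$ (0, 0) * v $ 0 + M $$ (0, 1) * v $ 1 + M $$ (0, 2) * v $ 2"
    and "(M *\<^sub>v v) $ 1 = M $$ (1, 0) * v $ 0 + M $$ (1, 1) * v $ 1 + M $$ (1, 2) * v $ 2"
    and "(M *\<^sub>v v) $ 2 = M $$ (2, 0) * v $ 0 + M $$ (2, 1) * v $ 1 + M $$ (2, 2) * v $ 2"
  using assms by (simp_all add: scalar_prod_def atLeast0LessThan_3 add.assoc)

lemma blaschke_matrix_carrier: "blaschke_matrix as \<in> carrier_mat (length as) (length as)"
  by (simp add: blaschke_matrix_def)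

lemma quadratic_form_blaschke_matrix3:
  fixes a b :: real and x y z :: complex
  defines "A \<equiv> 1 - a\<^sup>2" and "B \<equiv> 1 - b\<^sup>2"
  assumes "\<bar>a\<bar> \<le> 1"
  shows "(blaschke_matrix [of_real a, of_real a, of_real b] *\<^sub>v vec_of_list [x, y, z]) \<bullet>c vec_of_list [x, y, z] =
    of_real a * (x * cnj x) + of_real a * (y * cnj y) + of_real b * (z * cnj z) +
    of_real A * y * cnj x - of_real (a * sqrt A * sqrt B) * z * cnj x +
    of_real (sqrt A * sqrt B) * z * cnj y"
proof -
  have A: "0 \<le> A"
    using assms(3) by (simp add: A_def abs_square_le_1)
  then have ss: "complex_of_real (sqrt A) * of_real (sqrt A) = of_real A"
    by (simp flip: of_real_mult)
  have g: "{i<..<j} = {}" if "j \<le> Suc i" for i j :: nat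
    using that by auto
  have g02: "{0<..<2} = {Suc 0}"
    by auto
  let ?M = "blaschke_matrix [of_real a, of_real a, of_real b]" and ?X = "vec_of_list [x, y, z]"
  have M: "?M \<in> carrier_mat 3 3"
    using blaschke_matrix_carrier[of "[of_real a, of_real a, of_real b]"] by (simp add: numeral_3_eq_3)
  have X: "?X \<in> carrier_vec 3"
    by (rule carrier_vecI) simp
  have idx: "?X $ 0 = x" "?X $ 1 = y" "?X $ 2 = z"
    unfolding vec_of_list_index by simp_all
  have entries: "?M $$ (0, 0) = of_real a" "?M $$ (0, 1) = of_real A"
    "?M $$ (0, 2) = - of_real (a * sqrt A * sqrt B)"
    "?M $$ (1, 0) = 0" "?M $$ (1, 1) = of_real a" "?M $$ (1, 2) = of_real (sqrt A * sqrt B)"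
    "?M $$ (2, 0) = 0" "?M $$ (2, 1) = 0" "?M $$ (2, 2) = of_real b"
    using ss A by (simp_all add: blaschke_matrix_def g g02 A_def[symmetric] B_def[symmetric])
  show ?thesis
    unfolding inner_vec3[OF X] mult_mat_vec3[OF M X] idx entries by (simp add: algebra_simps)
qed

text \<open>The left side of \<open>det\<close> is four times the determinant of
  \<open>(c u + R) I - Re(cnj v M)\<close> for unimodular \<open>v\<close> with real part
  \<open>u\<close>. A nonzero vector on which this form is nonpositive has a Rayleigh quotient lying
  far enough in direction \<open>v\<close> for the support criterion.\<close>

lemma blaschke_matrix3_ball_subset_numerical_range:
  fixes a b c R :: real
  defines "A \<equiv> 1 - a\<^sup>2" and "B \<equiv> 1 - b\<^sup>2"
  assumes a: "\<bar>a\<bar> \<le> 1" and b: "\<bar>b\<bar> \<le> 1"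
    and det: "\<And>u. \<lbrakk>-1 \<le> u; u \<le> 1\<rbrakk> \<Longrightarrow>
      4 * (R + (c - a) * u)\<^sup>2 * (R - (b - c) * u) - A\<^sup>2 * (R - (b - c) * u)
        - A * B * (1 + a\<^sup>2) * (R + (c - a) * u) + a * A\<^sup>2 * B * u \<le> 0"
  shows "ball (of_real c) R \<subseteq> numerical_range (blaschke_matrix [of_real a, of_real a, of_real b])"
proof (rule ball_subset_convex)
  let ?M = "blaschke_matrix [of_real a, of_real a, of_real b]"
  have M: "?M \<in> carrier_mat 3 3"
    using blaschke_matrix_carrier[of "[of_real a, of_real a, of_real b]"] by (simp add: numeral_3_eq_3)
  show "convex (numerical_range ?M)"
    using M by (rule Toeplitz_Hausdorff)
  fix v :: complex assume v: "norm v = 1"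
  define u where "u = Re v"
  have A: "0 \<le> A" and B: "0 \<le> B"
    using a b by (auto simp: A_def B_def abs_square_le_1)
  have u: "-1 \<le> u" "u \<le> 1"
    using abs_Re_le_cmod[of v] v by (auto simp: u_def)
  define k where "k = sqrt A * sqrt B"
  have kk: "k\<^sup>2 = A * B"
    using A B by (simp add: k_def power_mult_distrib)
  define p where "p = R + (c - a) * u"
  define r where "r = R - (b - c) * u"
  \<comment> \<open>Off-diagonal entries of minus the Hermitian part of \<open>cnj v M\<close>; the
    diagonal of the shifted matrix is \<open>p\<close>, \<open>p\<close>, \<open>r\<close>.\<close>
  define e where "e = - cnj v * of_real (A / 2)"
  define f where "f = cnj v * of_real (a * k / 2)"
  define g where "g = - cnj v * of_real (k / 2)"
  have norms: "(cmod e)\<^sup>2 = A\<^sup>2 / 4" "(cmod f)\<^sup>2 = a\<^sup>2 * (A * B) / 4" "(cmod g)\<^sup>2 = A * B / 4"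
    using v by (simp_all add: e_def f_def g_def norm_mult power_mult_distrib power_divide
        kk)
  \<comment> \<open>The phases leave a single factor \<open>cnj v\<close>, which is why the
    determinant depends on \<open>v\<close> only through \<open>u\<close>.\<close>
  have "e * g * cnj f = (cnj v * v) * cnj v * of_real (a * A * k\<^sup>2 / 8)"
    by (simp add: e_def f_def g_def power2_eq_square)
  also have "cnj v * v = 1"
    using v by (metis complex_norm_square mult.commute of_real_1 power_one)
  finally have "e * g * cnj f = 1 * cnj v * of_real (a * A * k\<^sup>2 / 8)" .
  then have egf: "Re (e * g * cnj f) = u * (a * A * (A * B) / 8)"
    unfolding kk by (simp only: u_def) simp
  have "4 * (p * p * r - p * (cmod g)\<^sup>2 - p * (cmod f)\<^sup>2 - r * (cmod e)\<^sup>2 + 2 * Re (e * g * cnj f)) =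
      4 * p\<^sup>2 * r - A\<^sup>2 * r - A * B * (1 + a\<^sup>2) * p + a * A\<^sup>2 * B * u"
    unfolding norms egf by (simp add: algebra_simps power2_eq_square)
  also have "\<dots> \<le> 0"
    using det[OF u] by (simp add: p_def r_def)
  finally have "p * p * r - p * (cmod g)\<^sup>2 - p * (cmod f)\<^sup>2 - r * (cmod e)\<^sup>2 + 2 * Re (e * g * cnj f) \<le> 0"
    by simp
  then obtain x y z where xyz: "(x, y, z) \<noteq> (0, 0, 0)" and
    le: "p * (cmod x)\<^sup>2 + p * (cmod y)\<^sup>2 + r * (cmod z)\<^sup>2
      + 2 * Re (e * y * cnj x + f * z * cnj x + g * z * cnj y) \<le> 0"
    by (rule hermitian3_nonpos_vector)
  define X where "X = vec_of_list [x, y, z]"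
  have Xc: "X \<in> carrier_vec 3"
    unfolding X_def by (rule carrier_vecI) simp
  have idx: "X $ 0 = x" "X $ 1 = y" "X $ 2 = z"
    unfolding X_def vec_of_list_index by simp_all
  have X0: "X \<noteq> 0\<^sub>v 3"
    using xyz idx by auto
  have N: "Re (X \<bullet>c X) = (cmod x)\<^sup>2 + (cmod y)\<^sup>2 + (cmod z)\<^sup>2"
    unfolding cmod_power2 inner_vec3[OF Xc] idx by (simp add: power2_eq_square)
  let ?w = "((?M *\<^sub>v X) \<bullet>c X) / of_real (Re (X \<bullet>c X))"
  have "?w \<in> numerical_range ?M"
    using M Xc X0 by (rule quotient_in_numerical_range)
  moreover have "inner v (of_real c) + R \<le> inner v ?w"
  proof -
    have Npos: "Re (X \<bullet>c X) > 0"
      using Re_self_inner_pos Xc X0 .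
    have "Re (cnj v * ((?M *\<^sub>v X) \<bullet>c X)) - (c * u + R) * Re (X \<bullet>c X) =
        - (p * (cmod x)\<^sup>2 + p * (cmod y)\<^sup>2 + r * (cmod z)\<^sup>2
      + 2 * Re (e * y * cnj x + f * z * cnj x + g * z * cnj y))"
      unfolding X_def quadratic_form_blaschke_matrix3[OF a] N[unfolded X_def]
      unfolding A_def[symmetric] B_def[symmetric] mult.assoc k_def[symmetric]
      unfolding cmod_power2 p_def r_def e_def f_def g_def u_def
      by (simp add: algebra_simps power2_eq_square add_divide_distrib diff_divide_distrib)
    then have "(c * u + R) * Re (X \<bullet>c X) \<le> Re (cnj v * ((?M *\<^sub>v X) \<bullet>c X))"
      using le by linarith
    then have "c * u + R \<le> Re (cnj v * ((?M *\<^sub>v X) \<bullet>c X)) / Re (X \<bullet>c X)"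
      using Npos by (simp add: pos_le_divide_eq)
    also have "\<dots> = Re (cnj v * ?w)"
      by (metis Re_divide_of_real times_divide_eq_right)
    finally have "c * u + R \<le> Re (cnj v * ?w)" .
    moreover have "inner v (of_real c) = c * u"
      by (simp add: inner_complex_def u_def)
    moreover have "inner v w = Re (cnj v * w)" for w
      by (simp add: inner_complex_def)
    ultimately show ?thesis
      by (simp only:)
  qed
  ultimately show "\<exists>w\<in>numerical_range ?M. inner v (of_real c) + R \<le> inner v w"
    by blast
qed

text \<open>The hypothesis \<open>hR\<close> says that the pseudohyperbolic radius of \<open>ball c R\<close> is at least
  \<open>1 / sqrt 2\<close>. The hyperbolic centre \<open>s\<close> is chosen so that the Euclidean centre
  \<open>s / (2 - s\<^sup>2)\<close> of the pseudohyperbolic disk is \<open>c\<close>.\<close>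

lemma pseudohyperbolic_disk_subset_ball:
  fixes c R :: real
  assumes c: "0 \<le> c" "c < 1" and hR: "sqrt 2 * (1 - c\<^sup>2 + R\<^sup>2) \<le> 3 * R"
  shows "\<exists>z0\<in>ball 0 1. pseudohyperbolic_disk z0 (1 / sqrt 2) \<subseteq> ball (of_real c) R"
proof -
  have "\<exists>s\<ge>0. s \<le> 1 \<and> s / (2 - s\<^sup>2) = c"
  proof (rule IVT')
    have "2 - s\<^sup>2 \<noteq> 0" if "0 \<le> s" "s \<le> 1" for s :: real
      using power_mono[OF that(2,1), of 2] by simp
    then show "continuous_on {0..1} (\<lambda>s::real. s / (2 - s\<^sup>2))"
      by (intro continuous_intros) auto
  qed (use c in auto)
  then obtain s where s: "0 \<le> s" "s \<le> 1" and cs: "s / (2 - s\<^sup>2) = c"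
    by blast
  have "s \<noteq> 1"
    using c cs by auto
  then have s1: "s < 1"
    using s by simp
  then have ss: "s\<^sup>2 < 1"
    using s by (simp add: power_less_one_iff abs_square_less_1)
  define D where "D = 2 - s\<^sup>2"
  have D: "D > 1" "D \<le> 2" "s\<^sup>2 = 2 - D"
    using ss by (simp_all add: D_def)
  have cD: "c * D = s"
    using cs D(1) by (auto simp: D_def)
  \<comment> \<open>Euclidean radius of the pseudohyperbolic disk with centre \<open>s\<close> and
    radius \<open>1 / sqrt 2\<close>.\<close>
  define R' where "R' = sqrt 2 * (D - 1) / D"
  have R'D: "R' * D = sqrt 2 * (D - 1)"
    using D by (simp add: R'_def)
  have "R' \<le> R"
  proof (rule ccontr)
    assume "\<not> R' \<le> R"
    \<comment> \<open>\<open>R'\<close> and \<open>T\<close> are the roots of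
      \<open>X^2 - 3 / sqrt 2 * X + (1 - c^2)\<close>. By \<open>hR\<close> this quadratic is
      nonpositive at \<open>R\<close>, whereas \<open>R < R' \<le> T\<close> would make it
      positive.\<close>
    define T where "T = 3 / sqrt 2 - R'"
    have "sqrt 2 * R' \<le> 1"
      using D by (simp add: R'_def field_simps)
    then have "R' \<le> T"
      by (simp add: T_def field_simps)
    then have "(R - R') * (R - T) > 0"
      using \<open>\<not> R' \<le> R\<close> by (intro mult_neg_neg) auto
    moreover have "R' * T = 1 - c\<^sup>2"
    proof -
      have "D\<^sup>2 * (R' * T) = (R' * D) * (3 * D / sqrt 2 - R' * D)"
        by (simp add: T_def power2_eq_square algebra_simps)
      also have "\<dots> = (D - 1) * (3 * D - 2 * (D - 1))"
        unfolding R'D by (simp add: field_simps)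
      also have "\<dots> = D\<^sup>2 - (c * D)\<^sup>2"
        unfolding cD D(3) by (simp add: algebra_simps power2_eq_square)
      also have "\<dots> = D\<^sup>2 * (1 - c\<^sup>2)"
        by (simp add: algebra_simps power_mult_distrib)
      finally show ?thesis
        using D by simp
    qed
    moreover have "R' + T = 3 / sqrt 2"
      by (simp add: T_def)
    moreover have "(R - R') * (R - T) = R\<^sup>2 - (R' + T) * R + R' * T"
      by (simp add: power2_eq_square algebra_simps)
    ultimately have "R\<^sup>2 - 3 / sqrt 2 * R + (1 - c\<^sup>2) > 0"
      by simp
    then have "sqrt 2 * (R\<^sup>2 - 3 / sqrt 2 * R + (1 - c\<^sup>2)) > 0"
      by simp
    then show False
      using hR by (simp add: algebra_simps)
  qed
  have "pseudohyperbolic_disk (of_real s) (1 / sqrt 2) \<subseteq> ball (of_real c) R"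
  proof
    fix z assume "z \<in> pseudohyperbolic_disk (of_real s) (1 / sqrt 2)"
    then have z: "cmod z < 1" and "cmod ((z - of_real s) / (1 - of_real s * z)) < 1 / sqrt 2"
      by (auto simp: pseudohyperbolic_disk_def)
    moreover have "1 - of_real s * z \<noteq> 0"
    proof
      assume "1 - of_real s * z = 0"
      then have "of_real s * z = 1"
        by simp
      then have "s * cmod z = 1"
        using s by (metis abs_of_nonneg norm_mult norm_of_real norm_one)
      moreover have "s * cmod z \<le> 1 * cmod z"
        using s by (intro mult_right_mono) auto
      ultimately show False
        using z by simp
    qed
    ultimately have "cmod (z - of_real s) * sqrt 2 < cmod (1 - of_real s * z)"
      by (simp add: norm_divide field_simps)
    then have "(cmod (z - of_real s) * sqrt 2)\<^sup>2 < (cmod (1 - of_real s * z))\<^sup>2"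
      by (intro power_strict_mono) auto
    then have "2 * (cmod (z - of_real s))\<^sup>2 < (cmod (1 - of_real s * z))\<^sup>2"
      by (simp add: power_mult_distrib)
    then have "2 * ((Re z - s)\<^sup>2 + (Im z)\<^sup>2) < (1 - s * Re z)\<^sup>2 + (s * Im z)\<^sup>2"
      by (simp add: cmod_power2)
    then have "(2 - s\<^sup>2) * ((Re z)\<^sup>2 + (Im z)\<^sup>2) - 2 * s * Re z + 2 * s\<^sup>2 - 1 < 0"
      by (simp add: power2_eq_square algebra_simps)
    then have *: "D * ((Re z)\<^sup>2 + (Im z)\<^sup>2) - 2 * (c * D) * Re z + (3 - 2 * D) < 0"
      unfolding cD D(3) by simp
    \<comment> \<open>Completing the square turns the disk inequality into a bound on the distance
      to \<open>c\<close>.\<close>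
    have "D\<^sup>2 * (cmod (z - of_real c))\<^sup>2 =
        D * (D * ((Re z)\<^sup>2 + (Im z)\<^sup>2) - 2 * (c * D) * Re z + (3 - 2 * D)) + (c * D)\<^sup>2 - D * (3 - 2 * D)"
      unfolding cmod_power2 by (simp add: power2_eq_square algebra_simps)
    also have "\<dots> < (c * D)\<^sup>2 - D * (3 - 2 * D)"
      using * D by (simp add: mult_pos_neg)
    also have "\<dots> = 2 * (D - 1)\<^sup>2"
      unfolding cD D(3) by (simp add: power2_eq_square algebra_simps)
    also have "\<dots> = (R' * D)\<^sup>2"
      unfolding R'D by (simp add: power_mult_distrib)
    finally have "(cmod (z - of_real c))\<^sup>2 < R'\<^sup>2"
      using D by (simp add: power_mult_distrib mult.commute)
    moreover have "0 \<le> R'"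
      using D by (simp add: R'_def)
    ultimately have "cmod (z - of_real c) < R'"
      using power2_less_imp_less by blast
    with \<open>R' \<le> R\<close> show "z \<in> ball (of_real c) R"
      by (simp add: dist_norm norm_minus_commute)
  qed
  moreover have "complex_of_real s \<in> ball 0 1"
    using s s1 by simp
  ultimately show ?thesis
    by blast
qed

section \<open>Certified sign of integer polynomials on the unit interval\<close>

text \<open>Lowest degree first, with integer coefficients, so that certificates are decided by
  exact evaluation.\<close>

fun eval_poly :: "int list \<Rightarrow> real \<Rightarrow> real" where
  "eval_poly [] y = 0"
| "eval_poly (c # p) y = of_int c + y * eval_poly p y"

fun poly_add :: "int list \<Rightarrow> int list \<Rightarrow> int list" where
  "poly_add [] q = q"
| "poly_add p [] = p"
| "poly_add (c # p) (d # q) = (c + d) # poly_add p q"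

definition poly_scale :: "int \<Rightarrow> int list \<Rightarrow> int list" where
  "poly_scale k = map (\<lambda>c. k * c)"

definition poly_sub :: "int list \<Rightarrow> int list \<Rightarrow> int list" where
  "poly_sub p q = poly_add p (poly_scale (-1) q)"

fun poly_mul :: "int list \<Rightarrow> int list \<Rightarrow> int list" where
  "poly_mul [] q = []"
| "poly_mul (c # p) q = poly_add (poly_scale c q) (0 # poly_mul p q)"

fun poly_pow :: "int list \<Rightarrow> nat \<Rightarrow> int list" where
  "poly_pow p 0 = [1]"
| "poly_pow p (Suc n) = poly_mul p (poly_pow p n)"

lemma eval_poly_add [simp]: "eval_poly (poly_add p q) y = eval_poly p y + eval_poly q y"
  by (induction p q rule: poly_add.induct) (auto simp: algebra_simps)

lemma eval_poly_scale [simp]: "eval_poly (poly_scale k p) y = of_int k * eval_poly p y"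
  by (induction p) (auto simp: poly_scale_def algebra_simps)

lemma eval_poly_sub [simp]: "eval_poly (poly_sub p q) y = eval_poly p y - eval_poly q y"
  by (simp add: poly_sub_def)

lemma eval_poly_mul [simp]: "eval_poly (poly_mul p q) y = eval_poly p y * eval_poly q y"
  by (induction p) (auto simp: algebra_simps)

lemma eval_poly_pow [simp]: "eval_poly (poly_pow p n) y = eval_poly p y ^ n"
  by (induction n) auto

text \<open>The list \<open>[c\<^sub>0, \<dots>, c\<^sub>n]\<close> stands for the form \<open>\<Sum>c\<^sub>i x\<^bsup>n-i\<^esup> y\<^bsup>i\<^esup>\<close>,
  and \<open>bernstein p\<close> homogenises \<open>p\<close> by means of \<open>x + y = 1\<close>.\<close>

fun eval_form :: "int list \<Rightarrow> real \<Rightarrow> real \<Rightarrow> real" where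
  "eval_form [] x y = 0"
| "eval_form (c # p) x y = of_int c * x ^ length p + y * eval_form p x y"

text \<open>Expands \<open>c (x + y) ^ n\<close> by Pascal's rule: a trailing 0 multiplies a form by
  \<open>x\<close>, a leading 0 by \<open>y\<close>.\<close>

fun binomial_form :: "int \<Rightarrow> nat \<Rightarrow> int list" where
  "binomial_form c 0 = [c]"
| "binomial_form c (Suc n) = poly_add (binomial_form c n @ [0]) (0 # binomial_form c n)"

fun bernstein :: "int list \<Rightarrow> int list" where
  "bernstein [] = []"
| "bernstein (c # p) = poly_add (binomial_form c (length p)) (0 # bernstein p)"

definition bernstein_nonpos :: "int list \<Rightarrow> bool" where
  "bernstein_nonpos p \<longleftrightarrow> list_all (\<lambda>c. c \<le> 0) (bernstein p)"

lemma length_poly_add [simp]: "length p = length q \<Longrightarrow> length (poly_add p q) = length q"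
  by (induction p q rule: poly_add.induct) auto

lemma length_binomial_form [simp]: "length (binomial_form c n) = Suc n"
  by (induction n) auto

lemma length_bernstein [simp]: "length (bernstein p) = length p"
  by (induction p) auto

lemma eval_form_add:
  "length p = length q \<Longrightarrow> eval_form (poly_add p q) x y = eval_form p x y + eval_form q x y"
  by (induction p q rule: poly_add.induct) (auto simp: algebra_simps)

lemma eval_form_snoc0: "eval_form (p @ [0]) x y = x * eval_form p x y"
  by (induction p) (auto simp: algebra_simps)

lemma eval_binomial_form: "eval_form (binomial_form c n) x y = of_int c * (x + y) ^ n"
  by (induction n) (auto simp: eval_form_add eval_form_snoc0 algebra_simps)

lemma eval_bernstein: "eval_form (bernstein p) (1 - y) y = eval_poly p y"
  by (induction p) (auto simp: eval_form_add eval_binomial_form)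

lemma eval_form_nonpos:
  assumes "list_all (\<lambda>c. c \<le> 0) p" "0 \<le> x" "0 \<le> y"
  shows "eval_form p x y \<le> 0"
  using assms(1)
proof (induction p)
  case (Cons c p)
  then have "of_int c * x ^ length p \<le> 0" "y * eval_form p x y \<le> 0"
    using assms(2,3) by (auto intro: mult_nonpos_nonneg mult_nonneg_nonpos)
  then show ?case
    by simp
qed simp

text \<open>On the unit interval \<open>1 - y\<close> and \<open>y\<close> are nonnegative, so
  nonpositive coefficients suffice; the criterion is not necessary.\<close>

lemma eval_poly_nonpos:
  assumes "bernstein_nonpos p" "0 \<le> y" "y \<le> 1"
  shows "eval_poly p y \<le> 0"
  using eval_form_nonpos[of "bernstein p" "1 - y" y] assms
  by (simp add: eval_bernstein bernstein_nonpos_def)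

section \<open>Reduction to finitely many polynomial inequalities\<close>

text \<open>Four times the determinant in the disk criterion above, for the zeros \<open>a\<close>,
  \<open>a\<close>, \<open>b\<close>.\<close>

definition numrange_det :: "real \<Rightarrow> real \<Rightarrow> real \<Rightarrow> real \<Rightarrow> real \<Rightarrow> real" where
  "numrange_det a b c R u = (let A = 1 - a\<^sup>2; B = 1 - b\<^sup>2 in
     4 * (R + (c - a) * u)\<^sup>2 * (R - (b - c) * u) - A\<^sup>2 * (R - (b - c) * u)
       - A * B * (1 + a\<^sup>2) * (R + (c - a) * u) + a * A\<^sup>2 * B * u)"

text \<open>A convex function lies below its chord; the product subtracted in the identity is the
  defect times \<open>r - l\<close>.\<close>

lemma quadratic_nonpos_between:
  fixes q0 q1 q2 b l r :: real
  assumes "0 \<le> q2" "l \<le> b" "b \<le> r"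
    and "q0 + q1 * l + q2 * l\<^sup>2 \<le> 0" "q0 + q1 * r + q2 * r\<^sup>2 \<le> 0"
  shows "q0 + q1 * b + q2 * b\<^sup>2 \<le> 0"
proof (cases "l = r")
  case False
  then have lr: "l < r"
    using assms by simp
  have "(r - l) * (q0 + q1 * b + q2 * b\<^sup>2) =
      (r - b) * (q0 + q1 * l + q2 * l\<^sup>2) + (b - l) * (q0 + q1 * r + q2 * r\<^sup>2)
      - q2 * ((r - l) * (b - l) * (r - b))"
    by (simp add: power2_eq_square algebra_simps)
  also have "\<dots> \<le> 0"
  proof -
    have "(r - b) * (q0 + q1 * l + q2 * l\<^sup>2) \<le> 0" "(b - l) * (q0 + q1 * r + q2 * r\<^sup>2) \<le> 0"
      using assms by (auto intro: mult_nonneg_nonpos)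
    moreover have "0 \<le> q2 * ((r - l) * (b - l) * (r - b))"
      using assms by simp
    ultimately show ?thesis
      by linarith
  qed
  finally show ?thesis
    using lr by (simp add: mult_le_0_iff)
next
  case True
  then show ?thesis
    using assms by simp
qed

text \<open>This replaces \<open>root m t\<close>, which is not polynomial in \<open>t\<close>, by
  polynomial bounds. Up to the factor \<open>1 - a^2\<close>, \<open>conv\<close> is the
  nonnegativity of the coefficient of \<open>b^2\<close>.\<close>

lemma numrange_det_nonpos_between:
  assumes "\<bar>a\<bar> \<le> 1"
    and conv: "0 \<le> (1 + a\<^sup>2) * R + ((1 + a\<^sup>2) * (c - a) - a * (1 - a\<^sup>2)) * u"
    and "l \<le> b" "b \<le> r" "numrange_det a l c R u \<le> 0" "numrange_det a r c R u \<le> 0"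
  shows "numrange_det a b c R u \<le> 0"
proof -
  define A where "A = 1 - a\<^sup>2"
  define p where "p = R + (c - a) * u"
  define q0 where "q0 = (4 * p\<^sup>2 - A\<^sup>2) * (R + c * u) - A * (1 + a\<^sup>2) * p + a * A\<^sup>2 * u"
  define q1 where "q1 = - (4 * p\<^sup>2 - A\<^sup>2) * u"
  define q2 where "q2 = A * ((1 + a\<^sup>2) * R + ((1 + a\<^sup>2) * (c - a) - a * A) * u)"
  have eq: "numrange_det a b' c R u = q0 + q1 * b' + q2 * b'\<^sup>2" for b'
    unfolding numrange_det_def Let_def A_def[symmetric] p_def[symmetric] q0_def q1_def q2_def
    by (simp add: p_def power2_eq_square algebra_simps)
  have "0 \<le> q2"
    unfolding q2_def using assms by (intro mult_nonneg_nonneg) (auto simp: A_def abs_square_le_1)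
  then show ?thesis
    using quadratic_nonpos_between[of q2 l b r q0 q1] assms unfolding eq by blast
qed

text \<open>The four hypotheses are the signs of the Bernstein coefficients.\<close>

lemma cubic_nonpos_on_unit_interval:
  fixes k0 k1 k2 k3 u :: real
  assumes "k0 \<le> 0" "3 * k0 + k1 \<le> 0" "3 * k0 + 2 * k1 + k2 \<le> 0" "k0 + k1 + k2 + k3 \<le> 0"
    and "0 \<le> u" "u \<le> 1"
  shows "k0 + k1 * u + k2 * u\<^sup>2 + k3 * u ^ 3 \<le> 0"
proof -
  define v where "v = 1 - u"
  have "k0 * v ^ 3 + (3 * k0 + k1) * (v\<^sup>2 * u) + (3 * k0 + 2 * k1 + k2) * (v * u\<^sup>2)
      + (k0 + k1 + k2 + k3) * u ^ 3 \<le> 0"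
  proof -
    have "k0 * v ^ 3 \<le> 0" "(3 * k0 + k1) * (v\<^sup>2 * u) \<le> 0"
      "(3 * k0 + 2 * k1 + k2) * (v * u\<^sup>2) \<le> 0" "(k0 + k1 + k2 + k3) * u ^ 3 \<le> 0"
      using assms by (simp_all add: mult_nonpos_nonneg v_def)
    then show ?thesis
      by linarith
  qed
  then show ?thesis
    by (simp add: v_def power2_eq_square power3_eq_cube algebra_simps)
qed

text \<open>Reflection changes the signs of \<open>k1\<close> and \<open>k3\<close>. Both halves
  share the condition on \<open>k0\<close>, which leaves seven conditions.\<close>

lemma cubic_nonpos_on_symmetric_interval:
  fixes k0 k1 k2 k3 u :: real
  assumes "k0 \<le> 0"
    and "3 * k0 + k1 \<le> 0" "3 * k0 + 2 * k1 + k2 \<le> 0" "k0 + k1 + k2 + k3 \<le> 0"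
    and "3 * k0 - k1 \<le> 0" "3 * k0 - 2 * k1 + k2 \<le> 0" "k0 - k1 + k2 - k3 \<le> 0"
    and "-1 \<le> u" "u \<le> 1"
  shows "k0 + k1 * u + k2 * u\<^sup>2 + k3 * u ^ 3 \<le> 0"
proof (cases "0 \<le> u")
  case True
  then show ?thesis
    using assms by (intro cubic_nonpos_on_unit_interval)
next
  case False
  then show ?thesis
    using cubic_nonpos_on_unit_interval[of k0 "- k1" k2 "- k3" "- u"] assms by simp
qed

text \<open>Every quantity is a polynomial in the position \<open>y\<close> of \<open>a\<close> in a subinterval,
  scaled by \<open>1000\<close>; the factors \<open>N2\<close>, \<open>N4\<close> keep the expressions homogeneous.\<close>

definition det_check :: "int list \<Rightarrow> int list \<Rightarrow> int list \<Rightarrow> int list \<Rightarrow> bool" where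
  "det_check a b c R = (let
     N2 = [1000000]; N4 = [1000000000000];
     A = poly_sub N2 (poly_mul a a); B = poly_sub N2 (poly_mul b b); S = poly_add N2 (poly_mul a a);
     d = poly_sub c a; e = poly_sub b c;
     AB = poly_mul A B; A2 = poly_mul A A; R2 = poly_mul R R; ABS = poly_mul AB S;
     k0 = poly_sub (poly_sub (poly_scale 4 (poly_mul N4 (poly_mul R R2))) (poly_mul N2 (poly_mul A2 R)))
            (poly_mul ABS R);
     k1 = poly_add (poly_sub (poly_add (poly_scale 4 (poly_mul N4 (poly_mul R2 (poly_sub (poly_scale 2 d) e))))
            (poly_mul N2 (poly_mul A2 e))) (poly_mul ABS d)) (poly_mul a (poly_mul A AB));
     k2 = poly_scale 4 (poly_mul N4 (poly_mul R (poly_mul d (poly_sub d (poly_scale 2 e)))));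
     k3 = poly_scale (-4) (poly_mul N4 (poly_mul d (poly_mul d e)))
     in bernstein_nonpos k0 \<and>
        bernstein_nonpos (poly_add (poly_scale 3 k0) k1) \<and>
        bernstein_nonpos (poly_add (poly_add (poly_scale 3 k0) (poly_scale 2 k1)) k2) \<and>
        bernstein_nonpos (poly_add (poly_add k0 k1) (poly_add k2 k3)) \<and>
        bernstein_nonpos (poly_sub (poly_scale 3 k0) k1) \<and>
        bernstein_nonpos (poly_add (poly_sub (poly_scale 3 k0) (poly_scale 2 k1)) k2) \<and>
        bernstein_nonpos (poly_add (poly_sub k0 k1) (poly_sub k2 k3)))"

lemma det_check_sound:
  fixes y u :: real
  assumes chk: "det_check a b c R" and y: "0 \<le> y" "y \<le> 1" and u: "-1 \<le> u" "u \<le> 1"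
  shows "numrange_det (eval_poly a y / 1000) (eval_poly b y / 1000) (eval_poly c y / 1000)
    (eval_poly R y / 1000) u \<le> 0"
proof -
  define a' b' c' R' where "a' = eval_poly a y / 1000" and "b' = eval_poly b y / 1000"
    and "c' = eval_poly c y / 1000" and "R' = eval_poly R y / 1000"
  have ev: "eval_poly a y = 1000 * a'" "eval_poly b y = 1000 * b'"
    "eval_poly c y = 1000 * c'" "eval_poly R y = 1000 * R'"
    by (simp_all add: a'_def b'_def c'_def R'_def)
  define A B S d e where "A = 1 - a'\<^sup>2" and "B = 1 - b'\<^sup>2" and "S = 1 + a'\<^sup>2"
    and "d = c' - a'" and "e = b' - c'"
  define k0 where "k0 = 4 * R' ^ 3 - A\<^sup>2 * R' - A * B * S * R'"
  define k1 where "k1 = 4 * R'\<^sup>2 * (2 * d - e) + A\<^sup>2 * e - A * B * S * d + a' * A\<^sup>2 * B"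
  define k2 where "k2 = 4 * R' * d * (d - 2 * e)"
  define k3 where "k3 = - 4 * d\<^sup>2 * e"
  have scaled: "1000000 - 1000 * a' * (1000 * a') = 1000000 * A"
    "1000000 - 1000 * b' * (1000 * b') = 1000000 * B"
    "1000000 + 1000 * a' * (1000 * a') = 1000000 * S"
    "1000 * c' - 1000 * a' = 1000 * d" "1000 * b' - 1000 * c' = 1000 * e"
    by (simp_all add: A_def B_def S_def d_def e_def power2_eq_square)
  note chk' = chk[unfolded det_check_def Let_def]
  note ineq = chk'[THEN conjunct1, THEN eval_poly_nonpos, OF y]
    chk'[THEN conjunct2, THEN conjunct1, THEN eval_poly_nonpos, OF y]
    chk'[THEN conjunct2, THEN conjunct2, THEN conjunct1, THEN eval_poly_nonpos, OF y]
    chk'[THEN conjunct2, THEN conjunct2, THEN conjunct2, THEN conjunct1, THEN eval_poly_nonpos, OF y]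
    chk'[THEN conjunct2, THEN conjunct2, THEN conjunct2, THEN conjunct2, THEN conjunct1, THEN eval_poly_nonpos, OF y]
    chk'[THEN conjunct2, THEN conjunct2, THEN conjunct2, THEN conjunct2, THEN conjunct2, THEN conjunct1, THEN eval_poly_nonpos, OF y]
    chk'[THEN conjunct2, THEN conjunct2, THEN conjunct2, THEN conjunct2, THEN conjunct2, THEN conjunct2, THEN eval_poly_nonpos, OF y]
  have *: "numrange_det a' b' c' R' u = k0 + k1 * u + k2 * u\<^sup>2 + k3 * u ^ 3"
    unfolding numrange_det_def Let_def A_def[symmetric] B_def[symmetric] d_def[symmetric]
      e_def[symmetric] S_def[symmetric] k0_def k1_def k2_def k3_def
    by (simp add: power2_eq_square power3_eq_cube algebra_simps)
  show ?thesis
    unfolding a'_def[symmetric] b'_def[symmetric] c'_def[symmetric] R'_def[symmetric] *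
  proof (rule cubic_nonpos_on_symmetric_interval[OF _ _ _ _ _ _ _ u])
    note poly_simps = eval_poly_add eval_poly_sub eval_poly_mul eval_poly_scale eval_poly.simps ev
      of_int_numeral of_int_minus mult_zero_right add_0_right scaled
    \<comment> \<open>Padded by \<open>N2\<close> and \<open>N4\<close>, every term has weight 7 in
      the scale 1000, whence the common factor \<open>1000 ^ 7 = 10 ^ 21\<close>.\<close>
    have K0: "4 * (1000000000000 * (1000 * R' * (1000 * R' * (1000 * R'))))
       - 1000000 * (1000000 * A * (1000000 * A) * (1000 * R'))
       - 1000000 * A * (1000000 * B) * (1000000 * S) * (1000 * R') = 10 ^ 21 * k0"
      by (simp add: k0_def power2_eq_square power3_eq_cube algebra_simps)
    have K1: "4 * (1000000000000 * (1000 * R' * (1000 * R') * (2 * (1000 * d) - 1000 * e)))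
       + 1000000 * (1000000 * A * (1000000 * A) * (1000 * e))
       - 1000000 * A * (1000000 * B) * (1000000 * S) * (1000 * d)
       + 1000 * a' * (1000000 * A * (1000000 * A * (1000000 * B))) = 10 ^ 21 * k1"
      by (simp add: k1_def power2_eq_square algebra_simps)
    have K2: "4 * (1000000000000 * (1000 * R' * (1000 * d * (1000 * d - 2 * (1000 * e))))) = 10 ^ 21 * k2"
      by (simp add: k2_def algebra_simps)
    have K3: "- 4 * (1000000000000 * (1000 * d * (1000 * d * (1000 * e)))) = 10 ^ 21 * k3"
      by (simp add: k3_def power2_eq_square algebra_simps)
    note sgn = ineq[unfolded poly_simps K0 K1 K2 K3]
    show "k0 \<le> 0" using sgn(1) by simp
    show "3 * k0 + k1 \<le> 0" using sgn(2) by simp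
    show "3 * k0 + 2 * k1 + k2 \<le> 0" using sgn(3) by simp
    show "k0 + k1 + k2 + k3 \<le> 0" using sgn(4) by simp
    show "3 * k0 - k1 \<le> 0" using sgn(5) by simp
    show "3 * k0 - 2 * k1 + k2 \<le> 0" using sgn(6) by simp
    show "k0 - k1 + k2 - k3 \<le> 0" using sgn(7) by simp
  qed
qed

section \<open>Soundness of the certificates on a parameter interval\<close>

lemma pseudohyperbolic_disk_in_numerical_range:
  fixes a b c R :: real
  assumes "\<bar>a\<bar> \<le> 1" "\<bar>b\<bar> \<le> 1" "0 \<le> c" "c < 1"
    and "sqrt 2 * (1 - c\<^sup>2 + R\<^sup>2) \<le> 3 * R"
    and "\<And>u. \<lbrakk>-1 \<le> u; u \<le> 1\<rbrakk> \<Longrightarrow> numrange_det a b c R u \<le> 0"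
  shows "\<exists>z0\<in>ball 0 1. pseudohyperbolic_disk z0 (1 / sqrt 2) \<subseteq>
    numerical_range (blaschke_matrix [of_real a, of_real a, of_real b])"
  using pseudohyperbolic_disk_subset_ball[of c R] blaschke_matrix3_ball_subset_numerical_range[of a b R c] assms
  unfolding numrange_det_def Let_def by (meson subset_trans)

text \<open>The slightly larger decimal \<open>1.41422\<close> makes the radius condition a
  polynomial inequality with rational coefficients.\<close>

lemma sqrt2_mult_le:
  fixes x :: real
  assumes "0 \<le> x"
  shows "sqrt 2 * x \<le> 141422 / 100000 * x"
  using assms by (intro mult_right_mono real_le_lsqrt) (auto simp: power2_eq_square)

text \<open>\<open>l\<close> and \<open>r\<close> bound \<open>root m a\<close> for \<open>2 \<le> m \<le> M\<close>. The determinant is a convex function of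
  \<open>root m a\<close>, so it suffices to check its sign at \<open>l\<close> and \<open>r\<close>.\<close>

definition cell_check :: "nat \<Rightarrow> int list \<Rightarrow> int list \<Rightarrow> int list \<Rightarrow> int list \<Rightarrow> int list \<Rightarrow> bool" where
  "cell_check M a l r c R \<longleftrightarrow>
     bernstein_nonpos (poly_sub (poly_mul l l) (poly_scale 1000 a)) \<and>
     bernstein_nonpos (poly_sub (poly_scale (1000 ^ (M - 1)) a) (poly_pow r M)) \<and>
     bernstein_nonpos (poly_scale (-1) r) \<and>
     bernstein_nonpos (poly_scale (-1) c) \<and>
     bernstein_nonpos (poly_sub c [999]) \<and>
     bernstein_nonpos (poly_sub (poly_scale 141422
       (poly_add (poly_sub [1000000] (poly_mul c c)) (poly_mul R R))) (poly_scale 300000000 R)) \<and>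
     (let A = poly_sub [1000000] (poly_mul a a); S = poly_add [1000000] (poly_mul a a);
        g = poly_sub (poly_mul S (poly_sub c a)) (poly_mul a A) in
      bernstein_nonpos (poly_sub (poly_scale (-1) (poly_mul S R)) g) \<and>
      bernstein_nonpos (poly_sub g (poly_mul S R))) \<and>
     det_check a l c R \<and> det_check a r c R"

text \<open>Powers of \<open>b = root m t\<close> decrease with the exponent, so
  \<open>l'^2 \<le> t = b^m \<le> b^2\<close> and \<open>b^M \<le> b^m = t \<le> r'^M\<close>. Thus
  one certificate covers all \<open>m\<close> from 2 to \<open>M\<close>.\<close>

lemma cell_check_sound:
  fixes t y :: real
  assumes chk: "cell_check M a l r c R" and y: "0 \<le> y" "y \<le> 1"
    and t: "0 < t" "t < 1" "1000 * t = eval_poly a y" and m: "2 \<le> m" "m \<le> M"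
  shows "\<exists>z0\<in>ball 0 1. pseudohyperbolic_disk z0 (1 / sqrt 2) \<subseteq>
    numerical_range (blaschke_matrix (Phi_zeros m t))"
proof -
  define l' r' c' R' where "l' = eval_poly l y / 1000" and "r' = eval_poly r y / 1000"
    and "c' = eval_poly c y / 1000" and "R' = eval_poly R y / 1000"
  have ev: "eval_poly a y = 1000 * t" "eval_poly l y = 1000 * l'" "eval_poly r y = 1000 * r'"
    "eval_poly c y = 1000 * c'" "eval_poly R y = 1000 * R'"
    by (simp_all add: l'_def r'_def c'_def R'_def t)
  have nonpos: "eval_poly p y \<le> 0" if "bernstein_nonpos p" for p
    using eval_poly_nonpos that y .
  note chk' = chk[unfolded cell_check_def Let_def]
  have l: "l'\<^sup>2 \<le> t"
    using nonpos[of "poly_sub (poly_mul l l) (poly_scale 1000 a)"] chk'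
    by (simp add: ev power2_eq_square)
  have "1000 ^ (M - 1) * (1000 * t) \<le> (1000 * r') ^ M"
    using nonpos[of "poly_sub (poly_scale (1000 ^ (M - 1)) a) (poly_pow r M)"] chk'
    by (simp add: ev)
  \<comment> \<open>Since \<open>M\<close> is positive, the truncated difference
    \<open>M - 1\<close> is the true one.\<close>
  moreover have "1000 ^ (M - 1) * (1000 * t) = 1000 ^ M * t"
    using m by (cases M) auto
  ultimately have "1000 ^ M * t \<le> 1000 ^ M * r' ^ M"
    by (simp only: power_mult_distrib)
  then have r: "t \<le> r' ^ M"
    by simp
  have r0: "0 \<le> r'"
    using nonpos[of "poly_scale (-1) r"] chk' by (simp add: ev)
  \<comment> \<open>The bound \<open>999\<close> gives \<open>c' < 1\<close> from a nonstrict
    test.\<close>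
  have c: "0 \<le> c'" "c' < 1"
    using nonpos[of "poly_scale (-1) c"] nonpos[of "poly_sub c [999]"] chk' by (simp_all add: ev)
  have "141422 / 100000 * (1 - c'\<^sup>2 + R'\<^sup>2) \<le> 3 * R'"
    using nonpos[of "poly_sub (poly_scale 141422
       (poly_add (poly_sub [1000000] (poly_mul c c)) (poly_mul R R))) (poly_scale 300000000 R)"] chk'
    by (simp add: ev power2_eq_square)
  moreover have "0 \<le> 1 - c'\<^sup>2 + R'\<^sup>2"
    using c by (simp add: abs_square_le_1 add_nonneg_nonneg)
  ultimately have R: "sqrt 2 * (1 - c'\<^sup>2 + R'\<^sup>2) \<le> 3 * R'"
    using sqrt2_mult_le by fastforce
  \<comment> \<open>The convexity condition is \<open>0 \<le> (1 + t^2) R' + g u\<close>, affine in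
    \<open>u\<close>, so two sign tests cover all \<open>u\<close> between -1 and 1.\<close>
  define g where "g = (1 + t\<^sup>2) * (c' - t) - t * (1 - t\<^sup>2)"
  have conv: "- g \<le> (1 + t\<^sup>2) * R'" "g \<le> (1 + t\<^sup>2) * R'"
    using chk'[THEN conjunct2, THEN conjunct2, THEN conjunct2, THEN conjunct2, THEN conjunct2,
        THEN conjunct2, THEN conjunct1, THEN conjunct1, THEN nonpos]
      chk'[THEN conjunct2, THEN conjunct2, THEN conjunct2, THEN conjunct2, THEN conjunct2,
        THEN conjunct2, THEN conjunct1, THEN conjunct2, THEN nonpos]
    by (simp_all add: ev g_def power2_eq_square algebra_simps)
  define b where "b = root m t"
  have bm: "b ^ m = t" and b0: "0 < b" and b1: "b < 1"
    using m t by (auto simp: b_def)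
  have lb2: "l'\<^sup>2 \<le> b\<^sup>2"
    using power_decreasing[of 2 m b] m b0 b1 bm l by simp
  have lb: "l' \<le> b"
    using b0 by (intro power2_le_imp_le[OF lb2]) simp
  have "b ^ M \<le> r' ^ M"
    using power_decreasing[of m M b] m b0 b1 bm r by simp
  then have br: "b \<le> r'"
    using power_strict_mono[of r' b M] m r0 by (cases "r' < b") auto
  have "numrange_det t b c' R' u \<le> 0" if u: "-1 \<le> u" "u \<le> 1" for u
  proof (rule numrange_det_nonpos_between[OF _ _ lb br])
    have "\<bar>g * u\<bar> \<le> (1 + t\<^sup>2) * R' * 1"
      unfolding abs_mult using conv u by (intro mult_mono) auto
    then show "0 \<le> (1 + t\<^sup>2) * R' + ((1 + t\<^sup>2) * (c' - t) - t * (1 - t\<^sup>2)) * u"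
      unfolding g_def[symmetric] by linarith
    show "numrange_det t l' c' R' u \<le> 0" "numrange_det t r' c' R' u \<le> 0"
      using det_check_sound[of a l c R y u] det_check_sound[of a r c R y u] chk' y u
      by (simp_all add: ev)
  qed (use t in auto)
  then show ?thesis
    unfolding Phi_zeros_def b_def[symmetric] using t b0 b1 c R
    by (intro pseudohyperbolic_disk_in_numerical_range) auto
qed

lemma pseudohyperbolic_disk_on_cell:
  fixes t :: real
  assumes "cell_check M [\<alpha>, \<beta> - \<alpha>] l r c R" "0 < \<alpha>" "\<alpha> < \<beta>"
    and "\<alpha> \<le> 1000 * t" "1000 * t \<le> \<beta>" "t < 1" "2 \<le> m" "m \<le> M"
  shows "\<exists>z0\<in>ball 0 1. pseudohyperbolic_disk z0 (1 / sqrt 2) \<subseteq>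
    numerical_range (blaschke_matrix (Phi_zeros m t))"
proof (rule cell_check_sound[OF assms(1)])
  let ?y = "(1000 * t - \<alpha>) / (\<beta> - \<alpha>)"
  have "real_of_int \<alpha> < real_of_int \<beta>" "0 < real_of_int \<alpha>"
    using assms(2,3) by simp_all
  then show "0 \<le> ?y" "?y \<le> 1" "1000 * t = eval_poly [\<alpha>, \<beta> - \<alpha>] ?y" "0 < t"
    using assms by auto
qed (use assms in auto)

section \<open>Parameters close to 1\<close>

lemma numrange_det_large:
  fixes a b u :: real
  assumes "0 \<le> a" "\<bar>b\<bar> \<le> 1" "u \<le> 1"
  shows "numrange_det a b a ((1 - a\<^sup>2) / 2) u \<le> 0"
proof -
  \<comment> \<open>The closed disk with this centre and radius is the numerical range of the
    leading 2 by 2 block, so the leading minor vanishes for every \<open>u\<close> and only the last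
    two terms of the determinant survive.\<close>
  have "numrange_det a b a ((1 - a\<^sup>2) / 2) u = (1 - a\<^sup>2)\<^sup>2 * (1 - b\<^sup>2) * (a * u - (1 + a\<^sup>2) / 2)"
    by (simp add: numrange_det_def Let_def power2_eq_square field_simps)
  also have "\<dots> \<le> 0"
  proof (rule mult_nonneg_nonpos)
    have "a * u \<le> a"
      using assms mult_left_mono[of u 1 a] by simp
    moreover have "0 \<le> (1 - a)\<^sup>2"
      by simp
    then have "a \<le> (1 + a\<^sup>2) / 2"
      by (simp add: power2_eq_square algebra_simps)
    ultimately show "a * u - (1 + a\<^sup>2) / 2 \<le> 0"
      by simp
  qed (use assms in \<open>simp add: abs_square_le_1\<close>)
  finally show ?thesis .
qed

lemma pseudohyperbolic_disk_large_parameter: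
  fixes t :: real
  assumes t: "7 / 8 \<le> t" "t < 1" and m: "2 \<le> m"
  shows "\<exists>z0\<in>ball 0 1. pseudohyperbolic_disk z0 (1 / sqrt 2) \<subseteq>
    numerical_range (blaschke_matrix (Phi_zeros m t))"
  unfolding Phi_zeros_def
proof (rule pseudohyperbolic_disk_in_numerical_range)
  define A where "A = 1 - t\<^sup>2"
  \<comment> \<open>\<open>15 / 64\<close> is \<open>1 - (7 / 8)^2\<close>, small enough for
    \<open>1.41422 * (1 + A / 4) \<le> 3 / 2\<close>.\<close>
  have A: "0 \<le> A" "A \<le> 15 / 64"
    using t power_mono[of "7/8" t 2] power_le_one[of t 2] by (auto simp: A_def power2_eq_square)
  have root: "0 \<le> root m t" "root m t \<le> 1"
    using t m by auto
  show "\<bar>t\<bar> \<le> 1" "\<bar>root m t\<bar> \<le> 1" "0 \<le> t" "t < 1"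
    using t root by auto
  have eq: "1 - t\<^sup>2 + ((1 - t\<^sup>2) / 2)\<^sup>2 = A * (1 + A / 4)"
    by (simp add: A_def power2_eq_square field_simps)
  have "sqrt 2 * (A * (1 + A / 4)) \<le> 141422 / 100000 * (A * (1 + A / 4))"
    using A by (intro sqrt2_mult_le) simp
  also have "\<dots> = A * (141422 / 100000 * (1 + A / 4))"
    by simp
  also have "\<dots> \<le> A * (3 / 2)"
    using A by (intro mult_left_mono) auto
  finally show "sqrt 2 * (1 - t\<^sup>2 + ((1 - t\<^sup>2) / 2)\<^sup>2) \<le> 3 * ((1 - t\<^sup>2) / 2)"
    unfolding eq by (simp add: A_def)
  show "numrange_det t (root m t) t ((1 - t\<^sup>2) / 2) u \<le> 0" if "-1 \<le> u" "u \<le> 1" for u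
    using t root that by (intro numrange_det_large) auto
qed

text \<open>The coefficients were found numerically: \<open>l\<close> is a chord of \<open>sqrt a\<close>, \<open>r\<close> nearly a tangent
  of \<open>root M a\<close>.\<close>

lemma cell_check_1:
  "cell_check 2 [110, 270 - 110] [330, 189] [350, 195] [143, 137] [680, -52, -17]"
  by code_simp

lemma cell_check_2:
  "cell_check 3 [270, 410 - 270] [519, 121] [652, 95] [306, 106] [594, -70, -5]"
  by code_simp

lemma cell_check_3:
  "cell_check 4 [410, 500 - 410] [640, 67] [801, 42] [436, 78] [500, -61, -1]"
  by code_simp

lemma cell_check_4:
  "cell_check 6 [500, 620 - 500] [707, 80] [893, 32] [530, 106] [424, -88, -2]"
  by code_simp

lemma cell_check_5:
  "cell_check 7 [620, 875 - 620] [787, 148] [937, 47] [635, 240] [335, -211, -6]"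
  by code_simp

theorem theorem2p5:
  fixes m :: nat and t :: real
  assumes "2 \<le> m" and "m \<le> 7"
    and "threshold m < t" and "t < 1"
  shows "\<exists>z0 \<in> ball (0::complex) 1.
           pseudohyperbolic_disk z0 (1 / sqrt 2) \<subseteq> numerical_range (blaschke_matrix (Phi_zeros m t))"
proof -
  have "m \<in> {2, 3, 4, 5, 6, 7}"
    using assms(1,2) by auto
  then have lower: "0.11 < t" "m > 2 \<Longrightarrow> 0.27 < t" "m > 3 \<Longrightarrow> 0.41 < t" "m > 4 \<Longrightarrow> 0.5 < t"
    "m > 6 \<Longrightarrow> 0.62 < t"
    using assms(3) by (auto simp: threshold_def)
  \<comment> \<open>Each upper bound on \<open>m\<close> comes from the thresholds above the
    interval. The interval from 0.5 to 0.62 admits \<open>m = 6\<close> even below its threshold, so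
    0.57 is no endpoint; the last two cases allow every \<open>m\<close> up to 7.\<close>
  consider "110 \<le> 1000 * t" "1000 * t \<le> 270" "m \<le> 2"
    | "270 \<le> 1000 * t" "1000 * t \<le> 410" "m \<le> 3"
    | "410 \<le> 1000 * t" "1000 * t \<le> 500" "m \<le> 4"
    | "500 \<le> 1000 * t" "1000 * t \<le> 620" "m \<le> 6"
    | "620 \<le> 1000 * t" "1000 * t \<le> 875"
    | "7 / 8 \<le> t"
    using lower by (cases "t \<le> 0.27"; cases "t \<le> 0.41"; cases "t \<le> 0.5"; cases "t \<le> 0.62"; cases "t \<le> 7 / 8") force+
  then show ?thesis
  proof cases
    case 1
    then show ?thesis using assms by (intro pseudohyperbolic_disk_on_cell[OF cell_check_1]) auto
  next
    case 2
    then show ?thesis using assms by (intro pseudohyperbolic_disk_on_cell[OF cell_check_2]) auto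
  next
    case 3
    then show ?thesis using assms by (intro pseudohyperbolic_disk_on_cell[OF cell_check_3]) auto
  next
    case 4
    then show ?thesis using assms by (intro pseudohyperbolic_disk_on_cell[OF cell_check_4]) auto
  next
    case 5
    then show ?thesis using assms by (intro pseudohyperbolic_disk_on_cell[OF cell_check_5]) auto
  next
    case 6
    then show ?thesis using assms by (intro pseudohyperbolic_disk_large_parameter) auto
  qed
qed

end
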